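(* For every $g$, $\pi_1(\Sigma_g)\simeq\langle a_1,b_1,\ldots,a_g,b_g\mid [a_1,b_1]\cdots[a_g,b_g]=1\rangle$, where $[a,b]=aba^{-1}b^{-1}$.
   Context: Computational paths setting: paths are explicit rewrite sequences; $\sim$ is rewrite equality (equivalence closure of the $\mathrm{LND}_{\mathrm{EQ}}$-TRS, containing the groupoid laws); $\pi_1(A,a)=\mathrm{Path}(a,a)/{\sim}$. The orientable surface $\Sigma_g$ of genus $g$ is the higher-inductive type with a point $\mathrm{base}$, loops $a_1,b_1,\ldots,a_g,b_g:\mathrm{Path}(\mathrm{base},\mathrm{base})$, and a surface 2-cell witnessing $\prod_{i=1}^g[a_i,b_i]$ is trivial (i.e. $\bigvee_{2g}S^1$ with a disk attached along $\prod_i[a_i,b_i]$); $\pi_1$ is at $\mathrm{base}$. *)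

theory Defs
  imports "HOL-Algebra.Coset"
begin

section \<open>Quotients of an operation by a congruence\<close>

definition quotient_monoid ::
  "'a set \<Rightarrow> ('a \<times> 'a) set \<Rightarrow> ('a \<Rightarrow> 'a \<Rightarrow> 'a) \<Rightarrow> 'a \<Rightarrow> 'a set monoid" where
  "quotient_monoid C R f e =
     \<lparr>carrier = C // R,
      monoid.mult = (\<lambda>P Q. \<Union>p\<in>P. \<Union>q\<in>Q. R `` {f p q}),
      one = R `` {e}\<rparr>"

lemma quotient_monoid_mult:
  assumes "equiv C R" and "congruent2 R R (\<lambda>p q. R `` {f p q})" and "p \<in> C" and "q \<in> C"
  shows "R `` {p} \<otimes>\<^bsub>quotient_monoid C R f e\<^esub> R `` {q} = R `` {f p q}"
  using UN_equiv_class2[OF assms(1,1,2,3,4)] by (simp add: quotient_monoid_def)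

lemma group_quotient_monoid:
  assumes eq: "equiv C R"
    and f: "\<And>p q. p \<in> C \<Longrightarrow> q \<in> C \<Longrightarrow> f p q \<in> C" and e: "e \<in> C"
    and i: "\<And>p. p \<in> C \<Longrightarrow> i p \<in> C"
    and cong: "\<And>p p' q q'. (p, p') \<in> R \<Longrightarrow> (q, q') \<in> R \<Longrightarrow> (f p q, f p' q') \<in> R"
    and assoc: "\<And>p q r. p \<in> C \<Longrightarrow> q \<in> C \<Longrightarrow> r \<in> C \<Longrightarrow> (f (f p q) r, f p (f q r)) \<in> R"
    and unit: "\<And>p. p \<in> C \<Longrightarrow> (f e p, p) \<in> R"
    and inv: "\<And>p. p \<in> C \<Longrightarrow> (f (i p) p, e) \<in> R"
  shows "group (quotient_monoid C R f e)"
proof -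
  let ?G = "quotient_monoid C R f e"
  have c2: "congruent2 R R (\<lambda>p q. R `` {f p q})"
    by (rule congruent2I') (rule equiv_class_eq[OF eq cong])
  note m = quotient_monoid_mult[OF eq c2, where e = e]
  have car: "carrier ?G = C // R" and one: "\<one>\<^bsub>?G\<^esub> = R `` {e}"
    by (simp_all add: quotient_monoid_def)
  note cls = equiv_class_eq[OF eq]
  show ?thesis
  proof (rule groupI)
    show "\<one>\<^bsub>?G\<^esub> \<in> carrier ?G"
      by (simp add: car one quotientI e)
  next
    fix x y assume "x \<in> carrier ?G" "y \<in> carrier ?G"
    then show "x \<otimes>\<^bsub>?G\<^esub> y \<in> carrier ?G"
      unfolding car by (auto elim!: quotientE simp: m f quotientI)
  next
    fix x y z assume "x \<in> carrier ?G" "y \<in> carrier ?G" "z \<in> carrier ?G"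
    then show "x \<otimes>\<^bsub>?G\<^esub> y \<otimes>\<^bsub>?G\<^esub> z = x \<otimes>\<^bsub>?G\<^esub> (y \<otimes>\<^bsub>?G\<^esub> z)"
      unfolding car by (auto elim!: quotientE simp: m f cls[OF assoc])
  next
    fix x assume "x \<in> carrier ?G"
    then show "\<one>\<^bsub>?G\<^esub> \<otimes>\<^bsub>?G\<^esub> x = x"
      unfolding car one by (auto elim!: quotientE simp: m e cls[OF unit])
  next
    fix x assume "x \<in> carrier ?G"
    then obtain p where p: "p \<in> C" "x = R `` {p}"
      unfolding car by (auto elim!: quotientE)
    then have "R `` {i p} \<in> carrier ?G" "R `` {i p} \<otimes>\<^bsub>?G\<^esub> x = \<one>\<^bsub>?G\<^esub>"
      by (simp_all add: car one m i quotientI cls[OF inv])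
    then show "\<exists>y\<in>carrier ?G. y \<otimes>\<^bsub>?G\<^esub> x = \<one>\<^bsub>?G\<^esub>" by blast
  qed
qed


section \<open>Computational paths\<close>

text \<open>
  Explicit path terms: \<open>Refl x\<close> is \<open>\<rho>\<close> at the point \<open>x\<close>, \<open>Symm\<close> is \<open>\<sigma>\<close>, \<open>Trans\<close> is \<open>\<tau>\<close>
  (in diagrammatic order), and \<open>Gen e\<close> is the atomic path given by a path constructor \<open>e\<close>.
\<close>

datatype ('p, 'e) cpath =
    Refl 'p
  | Gen 'e
  | Symm "('p, 'e) cpath"
  | Trans "('p, 'e) cpath" "('p, 'e) cpath"

text \<open>
  A higher inductive type whose point constructors are the elements of \<open>'p\<close>, whose path
  constructors are \<open>edges\<close>, and whose 2-cells are pairs of parallel paths.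
\<close>

record ('p, 'e) hit =
  edges :: "'e set"
  src :: "'e \<Rightarrow> 'p"
  tgt :: "'e \<Rightarrow> 'p"
  cells :: "(('p, 'e) cpath \<times> ('p, 'e) cpath) set"

inductive is_path :: "('p, 'e) hit \<Rightarrow> 'p \<Rightarrow> 'p \<Rightarrow> ('p, 'e) cpath \<Rightarrow> bool"
  for H :: "('p, 'e) hit" where
  Refl: "is_path H x x (Refl x)"
| Gen: "e \<in> edges H \<Longrightarrow> is_path H (src H e) (tgt H e) (Gen e)"
| Symm: "is_path H x y p \<Longrightarrow> is_path H y x (Symm p)"
| Trans: "is_path H x y p \<Longrightarrow> is_path H y z q \<Longrightarrow> is_path H x z (Trans p q)"

definition Path :: "('p, 'e) hit \<Rightarrow> 'p \<Rightarrow> 'p \<Rightarrow> ('p, 'e) cpath set" where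
  "Path H x y = {p. is_path H x y p}"

text \<open>
  One-step rewriting \<open>rw H x y p q\<close> between parallel paths from \<open>x\<close> to \<open>y\<close>. The rules up to
  \<open>tst\<close> are, under their usual names, those rules of the LND_EQ-TRS whose terms involve only
  \<open>\<rho>\<close>, \<open>\<sigma>\<close> and \<open>\<tau>\<close>; the remaining rules of that system concern the constructors of products,
  sums and function types and substitution into a context, none of which occur in a type whose
  point constructors take no arguments. They are followed by the 2-cells of the type and by
  closure under term contexts.
\<close>

inductive rw :: "('p, 'e) hit \<Rightarrow> 'p \<Rightarrow> 'p \<Rightarrow> ('p, 'e) cpath \<Rightarrow> ('p, 'e) cpath \<Rightarrow> bool"
  for H :: "('p, 'e) hit" where
  sr: "rw H x x (Symm (Refl x)) (Refl x)"
| ss: "r \<in> Path H x y \<Longrightarrow> rw H x y (Symm (Symm r)) r"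
| tr: "r \<in> Path H x y \<Longrightarrow> rw H x x (Trans r (Symm r)) (Refl x)"
| tsr: "r \<in> Path H x y \<Longrightarrow> rw H y y (Trans (Symm r) r) (Refl y)"
| trr: "r \<in> Path H x y \<Longrightarrow> rw H x y (Trans r (Refl y)) r"
| tlr: "r \<in> Path H x y \<Longrightarrow> rw H x y (Trans (Refl x) r) r"
| stss: "r \<in> Path H x y \<Longrightarrow> s \<in> Path H y z \<Longrightarrow>
    rw H z x (Symm (Trans r s)) (Trans (Symm s) (Symm r))"
| tt: "t \<in> Path H w x \<Longrightarrow> r \<in> Path H x y \<Longrightarrow> s \<in> Path H y z \<Longrightarrow>
    rw H w z (Trans (Trans t r) s) (Trans t (Trans r s))"
| tts: "u \<in> Path H x y \<Longrightarrow> v \<in> Path H x z \<Longrightarrow> rw H x z (Trans u (Trans (Symm u) v)) v"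
| tst: "u \<in> Path H x y \<Longrightarrow> v \<in> Path H y z \<Longrightarrow> rw H y z (Trans (Symm u) (Trans u v)) v"
| cell: "(p, q) \<in> cells H \<Longrightarrow> p \<in> Path H x y \<Longrightarrow> q \<in> Path H x y \<Longrightarrow> rw H x y p q"
| symm_cong: "rw H x y p q \<Longrightarrow> rw H y x (Symm p) (Symm q)"
| trans_congL: "rw H x y p q \<Longrightarrow> s \<in> Path H y z \<Longrightarrow> rw H x z (Trans p s) (Trans q s)"
| trans_congR: "s \<in> Path H x y \<Longrightarrow> rw H y z p q \<Longrightarrow> rw H x z (Trans s p) (Trans s q)"

definition rweq :: "('p, 'e) hit \<Rightarrow> 'p \<Rightarrow> 'p \<Rightarrow> (('p, 'e) cpath \<times> ('p, 'e) cpath) set" where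
  "rweq H x y = {(p, q). p \<in> Path H x y \<and> q \<in> Path H x y \<and> equivclp (rw H x y) p q}"

definition pi1 :: "('p, 'e) hit \<Rightarrow> 'p \<Rightarrow> ('p, 'e) cpath set monoid" where
  "pi1 H x = quotient_monoid (Path H x x) (rweq H x x) Trans (Refl x)"

lemma Path_intros:
  "Refl x \<in> Path H x x"
  "e \<in> edges H \<Longrightarrow> Gen e \<in> Path H (src H e) (tgt H e)"
  "p \<in> Path H x y \<Longrightarrow> Symm p \<in> Path H y x"
  "p \<in> Path H x y \<Longrightarrow> q \<in> Path H y z \<Longrightarrow> Trans p q \<in> Path H x z"
  by (auto simp: Path_def intro: is_path.intros)

lemma rw_Path: "rw H x y p q \<Longrightarrow> p \<in> Path H x y \<and> q \<in> Path H x y"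
  by (induction rule: rw.induct) (auto intro: Path_intros)

lemma equiv_rweq: "equiv (Path H x y) (rweq H x y)"
  by (rule equivI) (auto simp: rweq_def refl_on_def sym_def trans_def
      intro: equivclp_sym equivclp_trans)

lemma rw_imp_rweq: "rw H x y p q \<Longrightarrow> (p, q) \<in> rweq H x y"
  using rw_Path[of H x y p q] by (auto simp: rweq_def)

lemma rweq_Trans:
  assumes "(p, p') \<in> rweq H x y" and "(q, q') \<in> rweq H y z"
  shows "(Trans p q, Trans p' q') \<in> rweq H x z"
proof -
  have *: "p \<in> Path H x y" "p' \<in> Path H x y" "q \<in> Path H y z" "q' \<in> Path H y z"
    using assms by (auto simp: rweq_def)
  have "equivclp (rw H x y) p p'" using assms(1) by (simp add: rweq_def)
  then have 1: "equivclp (rw H x z) (Trans p q) (Trans p' q)"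
  proof (induction rule: equivclp_induct)
    case (step u v)
    then have "rw H x z (Trans u q) (Trans v q) \<or> rw H x z (Trans v q) (Trans u q)"
      using *(3) by (blast intro: rw.trans_congL)
    with step.IH show ?case by (blast intro: equivclp_into_equivclp)
  qed simp
  have "equivclp (rw H y z) q q'" using assms(2) by (simp add: rweq_def)
  then have 2: "equivclp (rw H x z) (Trans p' q) (Trans p' q')"
  proof (induction rule: equivclp_induct)
    case (step u v)
    then have "rw H x z (Trans p' u) (Trans p' v) \<or> rw H x z (Trans p' v) (Trans p' u)"
      using *(2) by (blast intro: rw.trans_congR)
    with step.IH show ?case by (blast intro: equivclp_into_equivclp)
  qed simp
  show ?thesis
    using equivclp_trans[OF 1 2] * by (auto simp: rweq_def intro: Path_intros)
qed

lemma group_pi1: "group (pi1 H x)"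
  unfolding pi1_def
  by (rule group_quotient_monoid[where i = Symm])
    (auto intro: equiv_rweq Path_intros rweq_Trans rw_imp_rweq rw.intros)


section \<open>Group presentations\<close>

text \<open>A letter is a generator with a sign; \<open>(x, True)\<close> stands for \<open>x\<close>, \<open>(x, False)\<close> for its inverse.\<close>

type_synonym 'a word = "('a \<times> bool) list"

definition words :: "'a set \<Rightarrow> 'a word set" where
  "words X = lists (X \<times> UNIV)"

inductive cancel :: "'a set \<Rightarrow> 'a word \<Rightarrow> 'a word \<Rightarrow> bool" for X :: "'a set" where
  "u \<in> words X \<Longrightarrow> v \<in> words X \<Longrightarrow> x \<in> X \<Longrightarrow> cancel X (u @ [(x, b), (x, \<not> b)] @ v) (u @ v)"

definition word_rel :: "'a set \<Rightarrow> ('a word \<times> 'a word) set" where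
  "word_rel X = {(u, v). u \<in> words X \<and> v \<in> words X \<and> equivclp (cancel X) u v}"

definition free_group :: "'a set \<Rightarrow> 'a word set monoid" where
  "free_group X = quotient_monoid (words X) (word_rel X) (@) []"

definition normal_closure :: "('a, 'b) monoid_scheme \<Rightarrow> 'a set \<Rightarrow> 'a set" where
  "normal_closure G S = \<Inter>{N. N \<lhd> G \<and> S \<subseteq> N}"

text \<open>\<open>presented_group X R\<close> is the group with generators \<open>X\<close> and relations \<open>r = 1\<close> for \<open>r \<in> R\<close>.\<close>

definition presented_group :: "'a set \<Rightarrow> 'a word set \<Rightarrow> 'a word set set monoid" where
  "presented_group X R =
     free_group X Mod normal_closure (free_group X) ((\<lambda>r. word_rel X `` {r}) ` R)"

lemma words_simps [simp]:
  "[] \<in> words X"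
  "l # w \<in> words X \<longleftrightarrow> fst l \<in> X \<and> w \<in> words X"
  "u @ v \<in> words X \<longleftrightarrow> u \<in> words X \<and> v \<in> words X"
  "rev w \<in> words X \<longleftrightarrow> w \<in> words X"
  "map (apsnd f) w \<in> words X \<longleftrightarrow> w \<in> words X"
  by (force simp: words_def in_lists_conv_set mem_Times_iff)+

lemma equiv_word_rel: "equiv (words X) (word_rel X)"
  by (rule equivI) (auto simp: word_rel_def refl_on_def sym_def trans_def
      intro: equivclp_sym equivclp_trans)

lemma cancel_append:
  assumes "cancel X u v" and "w \<in> words X"
  shows "cancel X (u @ w) (v @ w)" and "cancel X (w @ u) (w @ v)"
proof -
  obtain a b x s where *: "u = a @ [(x, s), (x, \<not> s)] @ b" "v = a @ b"
      "a \<in> words X" "b \<in> words X" "x \<in> X"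
    using assms(1) by (auto elim: cancel.cases)
  show "cancel X (u @ w) (v @ w)"
    using cancel.intros[of a X "b @ w" x s] * assms(2) by simp
  show "cancel X (w @ u) (w @ v)"
    using cancel.intros[of "w @ a" X b x s] * assms(2) by simp
qed

lemma word_rel_append:
  assumes "(u, u') \<in> word_rel X" and "(v, v') \<in> word_rel X"
  shows "(u @ v, u' @ v') \<in> word_rel X"
proof -
  have *: "u \<in> words X" "u' \<in> words X" "v \<in> words X" "v' \<in> words X"
    using assms by (auto simp: word_rel_def)
  have "equivclp (cancel X) u u'" using assms(1) by (simp add: word_rel_def)
  then have 1: "equivclp (cancel X) (u @ v) (u' @ v)"
  proof (induction rule: equivclp_induct)
    case (step a b)
    then have "cancel X (a @ v) (b @ v) \<or> cancel X (b @ v) (a @ v)"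
      using *(3) by (blast intro: cancel_append)
    with step.IH show ?case by (blast intro: equivclp_into_equivclp)
  qed simp
  have "equivclp (cancel X) v v'" using assms(2) by (simp add: word_rel_def)
  then have 2: "equivclp (cancel X) (u' @ v) (u' @ v')"
  proof (induction rule: equivclp_induct)
    case (step a b)
    then have "cancel X (u' @ a) (u' @ b) \<or> cancel X (u' @ b) (u' @ a)"
      using *(2) by (blast intro: cancel_append)
    with step.IH show ?case by (blast intro: equivclp_into_equivclp)
  qed simp
  show ?thesis
    using equivclp_trans[OF 1 2] * by (auto simp: word_rel_def)
qed

lemma word_rel_inverse:
  assumes "w \<in> words X"
  shows "(rev (map (apsnd Not) w) @ w, []) \<in> word_rel X"
  using assms
proof (induction w)
  case Nil
  then show ?case by (simp add: word_rel_def)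
next
  case (Cons l w)
  obtain x b where l: "l = (x, b)" by (cases l)
  let ?i = "rev (map (apsnd Not) w)"
  have w: "w \<in> words X" "x \<in> X" "?i \<in> words X" using Cons.prems l by auto
  have "cancel X (?i @ [(x, \<not> b), (x, \<not> \<not> b)] @ w) (?i @ w)"
    by (rule cancel.intros) (use w in auto)
  then have "(rev (map (apsnd Not) (l # w)) @ l # w, ?i @ w) \<in> word_rel X"
    using w l by (auto simp: word_rel_def)
  with Cons.IH[OF w(1)] show ?case
    using equiv_word_rel[of X] by (meson equivE transE)
qed

lemma group_free_group: "group (free_group X)"
proof -
  have refl: "(u, u) \<in> word_rel X" if "u \<in> words X" for u
    using that by (simp add: word_rel_def)
  show ?thesis
    unfolding free_group_def
    by (rule group_quotient_monoid[where i = "\<lambda>w. rev (map (apsnd Not) w)"])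
      (auto intro: equiv_word_rel word_rel_append word_rel_inverse refl)
qed

lemma (in group) normal_normal_closure:
  assumes "S \<subseteq> carrier G"
  shows "normal_closure G S \<lhd> G"
proof -
  have "carrier G \<lhd> G"
    by (simp add: normal_inv_iff subgroup_self)
  with assms have car: "carrier G \<in> {N. N \<lhd> G \<and> S \<subseteq> N}" by simp
  show ?thesis
    unfolding normal_closure_def
  proof (rule normal_invI)
    show "subgroup (\<Inter>{N. N \<lhd> G \<and> S \<subseteq> N}) G"
      using car by (intro subgroups_Inter) (auto dest: normal_imp_subgroup)
  qed (auto intro: normal_invE)
qed

lemma group_presented_group:
  assumes "R \<subseteq> words X"
  shows "group (presented_group X R)"
proof -
  have "(\<lambda>r. word_rel X `` {r}) ` R \<subseteq> carrier (free_group X)"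
    using assms by (auto simp: free_group_def quotient_monoid_def intro: quotientI)
  then show ?thesis
    unfolding presented_group_def
    by (intro normal.factorgroup_is_group group.normal_normal_closure group_free_group)
qed


section \<open>Orientable surfaces\<close>

datatype surface_point = base

datatype surface_gen = loop_a nat | loop_b nat

definition surface_gens :: "nat \<Rightarrow> surface_gen set" where
  "surface_gens g = loop_a ` {1..g} \<union> loop_b ` {1..g}"

definition comm_path :: "('p, 'e) cpath \<Rightarrow> ('p, 'e) cpath \<Rightarrow> ('p, 'e) cpath" where
  "comm_path p q = Trans (Trans (Trans p q) (Symm p)) (Symm q)"

definition surface_path :: "nat \<Rightarrow> (surface_point, surface_gen) cpath" where
  "surface_path g =
     foldr (\<lambda>i. Trans (comm_path (Gen (loop_a i)) (Gen (loop_b i)))) [1..<Suc g] (Refl base)"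

definition Sigma_surface :: "nat \<Rightarrow> (surface_point, surface_gen) hit" where
  "Sigma_surface g =
     \<lparr>edges = surface_gens g, src = (\<lambda>_. base), tgt = (\<lambda>_. base),
      cells = {(surface_path g, Refl base)}\<rparr>"

definition comm_word :: "'a \<Rightarrow> 'a \<Rightarrow> 'a word" where
  "comm_word x y = [(x, True), (y, True), (x, False), (y, False)]"

definition surface_word :: "nat \<Rightarrow> surface_gen word" where
  "surface_word g = concat (map (\<lambda>i. comm_word (loop_a i) (loop_b i)) [1..<Suc g])"

lemma surface_path_in_Path: "surface_path g \<in> Path (Sigma_surface g) base base"
proof -
  have gen: "Gen e \<in> Path (Sigma_surface g) base base" if "e \<in> surface_gens g" for e
    using Path_intros(2)[of e "Sigma_surface g"] that by (simp add: Sigma_surface_def)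
  have "foldr (\<lambda>i. Trans (comm_path (Gen (loop_a i)) (Gen (loop_b i)))) is (Refl base)
      \<in> Path (Sigma_surface g) base base" if "set is \<subseteq> {1..g}" for "is"
    using that
    by (induction "is") (auto simp: comm_path_def surface_gens_def intro!: Path_intros gen)
  then show ?thesis by (simp add: surface_path_def atLeastLessThanSuc_atLeastAtMost del: upt_Suc)
qed

lemma surface_word_in_words: "surface_word g \<in> words (surface_gens g)"
  by (auto simp: surface_word_def comm_word_def words_def surface_gens_def)

end

theory Submission
  imports Defs
begin

text \<open>
  Reading a path as a word turns \<open>Trans\<close> into concatenation and \<open>Symm\<close> into formal inversion.
  If every edge is a loop at \<open>x\<close>, sending a generator to the class of its loop extends to a
  surjection \<open>\<phi>\<close> from the free group on the edges onto \<open>\<pi>\<^sub>1\<close>, with \<open>\<phi> [w] = [p]\<close> whenever \<open>p\<close>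
  reads as \<open>w\<close>. Each 2-cell puts its relator in the kernel. Conversely, every rewrite rule becomes
  an identity after evaluation in the presented group, so a word whose path rewrites
  to \<open>Refl x\<close> is trivial there. Hence the kernel is exactly the normal closure of the
  relators, and the first isomorphism theorem applies.
\<close>

section \<open>Evaluating words in a group\<close>

definition word_inv :: "'a word \<Rightarrow> 'a word" where
  "word_inv w = rev (map (apsnd Not) w)"

lemma word_inv_in_words [simp]: "word_inv w \<in> words X \<longleftrightarrow> w \<in> words X"
  by (simp add: word_inv_def)

primrec word_eval :: "('g, 'm) monoid_scheme \<Rightarrow> ('a \<Rightarrow> 'g) \<Rightarrow> 'a word \<Rightarrow> 'g" where
  "word_eval G h [] = \<one>\<^bsub>G\<^esub>"
| "word_eval G h (l # w) =
     (if snd l then h (fst l) else inv\<^bsub>G\<^esub> h (fst l)) \<otimes>\<^bsub>G\<^esub> word_eval G h w"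

context group
begin

lemma word_eval_closed:
  assumes "h \<in> X \<rightarrow> carrier G" and "w \<in> words X"
  shows "word_eval G h w \<in> carrier G"
  using assms(2) by (induction w) (use assms(1) in auto)

lemma word_eval_append:
  assumes "h \<in> X \<rightarrow> carrier G" and "u \<in> words X" and "v \<in> words X"
  shows "word_eval G h (u @ v) = word_eval G h u \<otimes> word_eval G h v"
  using assms(2)
proof (induction u)
  case Nil
  then show ?case using word_eval_closed[OF assms(1,3)] by simp
next
  case (Cons l u)
  have "h (fst l) \<in> carrier G" using assms(1) Cons.prems by auto
  then show ?case
    using Cons word_eval_closed[OF assms(1,3)] word_eval_closed[OF assms(1), of u]
    by (simp add: m_assoc)
qed

lemma word_eval_word_inv:
  assumes "h \<in> X \<rightarrow> carrier G" and "w \<in> words X"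
  shows "word_eval G h (word_inv w) = inv (word_eval G h w)"
  using assms(2)
proof (induction w)
  case Nil
  then show ?case by (simp add: word_inv_def)
next
  case (Cons l w)
  have h: "h (fst l) \<in> carrier G" using assms(1) Cons.prems by auto
  have "word_inv (l # w) = word_inv w @ [apsnd Not l]" by (simp add: word_inv_def)
  then show ?case
    using Cons h word_eval_closed[OF assms(1), of w]
      word_eval_append[OF assms(1), of "word_inv w" "[apsnd Not l]"]
    by (simp add: inv_mult_group)
qed

text \<open>A 2-cell contributes a single relator, the word of one side followed by the inverse word
  of the other. This turns triviality of such a relator back into equality of the two sides.\<close>

lemma word_eval_eq_if_quotient_one:
  assumes "h \<in> X \<rightarrow> carrier G" and "u \<in> words X" and "v \<in> words X"
    and "word_eval G h (u @ word_inv v) = \<one>"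
  shows "word_eval G h u = word_eval G h v"
proof -
  have "word_eval G h u \<otimes> inv (word_eval G h v) = \<one>"
    using assms by (simp add: word_eval_append word_eval_word_inv)
  then show ?thesis
    using inv_equality word_eval_closed[OF assms(1)] assms(2,3) inv_closed inv_inv by metis
qed

text \<open>For either sign \<open>b\<close>, the two cancelled letters evaluate to mutually inverse
  elements.\<close>

lemma word_eval_cancel:
  assumes "h \<in> X \<rightarrow> carrier G" and "cancel X u v"
  shows "word_eval G h u = word_eval G h v"
  using assms(2)
proof cases
  case (1 u' v' x b)
  have h: "h x \<in> carrier G" using assms(1) 1 by auto
  have "word_eval G h ([(x, b), (x, \<not> b)] @ v') = word_eval G h v'"
    using h word_eval_closed[OF assms(1), of v'] 1 by (simp add: m_assoc[symmetric])
  then show ?thesis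
    using 1 word_eval_append[OF assms(1), of u' "[(x, b), (x, \<not> b)] @ v'"]
      word_eval_append[OF assms(1), of u' v'] by simp
qed

lemma word_eval_word_rel:
  assumes "h \<in> X \<rightarrow> carrier G" and "(u, v) \<in> word_rel X"
  shows "word_eval G h u = word_eval G h v"
proof -
  have "equivclp (cancel X) u v" using assms(2) by (simp add: word_rel_def)
  then show ?thesis
    by (induction rule: equivclp_induct) (auto dest: word_eval_cancel[OF assms(1)])
qed

end

section \<open>The universal property of the free group\<close>

lemma carrier_free_group: "carrier (free_group X) = words X // word_rel X"
  by (simp add: free_group_def quotient_monoid_def)

lemma free_group_one: "\<one>\<^bsub>free_group X\<^esub> = word_rel X `` {[]}"
  by (simp add: free_group_def quotient_monoid_def)

lemma free_group_mult:
  assumes "u \<in> words X" and "v \<in> words X"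
  shows "word_rel X `` {u} \<otimes>\<^bsub>free_group X\<^esub> word_rel X `` {v} = word_rel X `` {u @ v}"
  unfolding free_group_def
  by (rule quotient_monoid_mult[OF equiv_word_rel _ assms], rule congruent2I')
    (rule equiv_class_eq[OF equiv_word_rel word_rel_append])

lemma free_group_inv:
  assumes "w \<in> words X"
  shows "inv\<^bsub>free_group X\<^esub> (word_rel X `` {w}) = word_rel X `` {word_inv w}"
proof (rule group.inv_equality[OF group_free_group])
  show "word_rel X `` {word_inv w} \<otimes>\<^bsub>free_group X\<^esub> word_rel X `` {w} = \<one>\<^bsub>free_group X\<^esub>"
    using assms word_rel_inverse[OF assms] equiv_class_eq[OF equiv_word_rel]
    by (simp add: free_group_mult free_group_one word_inv_def)
qed (use assms in \<open>auto simp: carrier_free_group intro: quotientI\<close>)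

text \<open>When \<open>h\<close> maps the generators into the group, evaluation is constant on each
  class, so the image is a singleton and \<open>the_elem\<close> avoids choosing a
  representative.\<close>

definition free_lift :: "('g, 'm) monoid_scheme \<Rightarrow> ('a \<Rightarrow> 'g) \<Rightarrow> 'a word set \<Rightarrow> 'g" where
  "free_lift G h A = the_elem (word_eval G h ` A)"

lemma (in group) free_lift_class:
  assumes "h \<in> X \<rightarrow> carrier G" and "w \<in> words X"
  shows "free_lift G h (word_rel X `` {w}) = word_eval G h w"
proof -
  have "w \<in> word_rel X `` {w}"
    using equiv_class_self[OF equiv_word_rel assms(2)] .
  moreover have "word_eval G h v = word_eval G h w" if "v \<in> word_rel X `` {w}" for v
    using word_eval_word_rel[OF assms(1), of w v] that by simp
  ultimately have "word_eval G h ` (word_rel X `` {w}) = {word_eval G h w}" by blast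
  then show ?thesis by (simp add: free_lift_def)
qed

lemma (in group) free_lift_hom:
  assumes "h \<in> X \<rightarrow> carrier G"
  shows "free_lift G h \<in> hom (free_group X) G"
proof (rule homI)
  fix A assume "A \<in> carrier (free_group X)"
  then obtain u where u: "u \<in> words X" "A = word_rel X `` {u}"
    unfolding carrier_free_group by (rule quotientE)
  then show "free_lift G h A \<in> carrier G"
    by (simp add: free_lift_class[OF assms] word_eval_closed[OF assms])
  fix B assume "B \<in> carrier (free_group X)"
  then obtain v where "v \<in> words X" "B = word_rel X `` {v}"
    unfolding carrier_free_group by (rule quotientE)
  with u show "free_lift G h (A \<otimes>\<^bsub>free_group X\<^esub> B) = free_lift G h A \<otimes> free_lift G h B"
    by (simp add: free_group_mult free_lift_class[OF assms] word_eval_append[OF assms])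
qed

text \<open>The uniqueness half of the universal property. It is applied below to the projection
  onto cosets of the normal closure.\<close>

lemma (in group) hom_free_group_eq_word_eval:
  assumes "f \<in> hom (free_group X) G" and "w \<in> words X"
  shows "f (word_rel X `` {w}) = word_eval G (\<lambda>x. f (word_rel X `` {[(x, True)]})) w"
  using assms(2)
proof (induction w)
  interpret f: group_hom "free_group X" G f
    using assms(1) group_free_group by (simp add: group_hom_def group_hom_axioms_def is_group)
  {
    case Nil
    then show ?case using f.hom_one by (simp add: free_group_one)
  next
    case (Cons l w)
    obtain x b where l: "l = (x, b)" by (cases l)
    have x: "[(x, b)] \<in> words X" "[(x, True)] \<in> words X" "w \<in> words X"
      using Cons.prems l by auto
    have cls: "word_rel X `` {u} \<in> carrier (free_group X)" if "u \<in> words X" for u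
      using that by (simp add: carrier_free_group quotientI)
    \<comment> \<open>The generator map records positive letters only, so a negative letter has to
      be traced back to its positive counterpart.\<close>
    have "f (word_rel X `` {[(x, False)]}) = inv (f (word_rel X `` {[(x, True)]}))"
      using free_group_inv[OF x(2)] f.hom_inv[OF cls[OF x(2)]] by (simp add: word_inv_def)
    then show ?case
      using Cons.IH[OF x(3)] l
        f.hom_mult[OF cls[OF x(1)] cls[OF x(3)], unfolded free_group_mult[OF x(1,3)]]
      by (cases b) simp_all
  }
qed

section \<open>Reading paths as words\<close>

primrec path_word :: "('p, 'e) cpath \<Rightarrow> 'e word" where
  "path_word (Refl x) = []"
| "path_word (Gen e) = [(e, True)]"
| "path_word (Symm p) = word_inv (path_word p)"
| "path_word (Trans p q) = path_word p @ path_word q"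

lemma path_word_in_words:
  assumes "p \<in> Path H x y"
  shows "path_word p \<in> words (edges H)"
proof -
  have "is_path H x y p" using assms by (simp add: Path_def)
  then show ?thesis by induction auto
qed

definition cell_words :: "('p, 'e) hit \<Rightarrow> 'e word set" where
  "cell_words H = (\<lambda>(p, q). path_word p @ word_inv (path_word q)) ` cells H"

text \<open>The rules from \<open>sr\<close> to \<open>tst\<close> become group identities, and the
  congruence rules follow from multiplicativity of evaluation; only the 2-cells need an assumption.
  The endpoints are arbitrary because \<open>path_word\<close> forgets vertices.\<close>

lemma (in group) word_eval_rw:
  assumes h: "h \<in> edges H \<rightarrow> carrier G"
    and cells: "\<And>p q. (p, q) \<in> cells H \<Longrightarrow>
      word_eval G h (path_word p) = word_eval G h (path_word q)"
    and "rw H x y p q"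
  shows "word_eval G h (path_word p) = word_eval G h (path_word q)"
proof -
  note W = path_word_in_words
  note E = word_eval_closed[OF h W]
  note S = word_eval_append[OF h] word_eval_word_inv[OF h] inv_mult_group m_assoc
  \<comment> \<open>In products bracketed to the right, an element is not grouped with its inverse;
    these are the cancellations that \<open>tts\<close> and \<open>tst\<close> call for.\<close>
  have inv_cancel: "a \<otimes> (inv a \<otimes> b) = b" "inv a \<otimes> (a \<otimes> b) = b"
    if "a \<in> carrier G" "b \<in> carrier G" for a b
    using that by (simp_all add: m_assoc[symmetric])
  from assms(3) show ?thesis
  proof induction
    case sr
    then show ?case by (simp add: word_inv_def)
  next
    case (cell p q)
    then show ?case by (blast intro: cells)
  next
    case (symm_cong x y p q)
    then show ?case using rw_Path[OF symm_cong.hyps] W by (metis S(2) path_word.simps(3))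
  next
    case (trans_congL x y p q s z)
    then show ?case using rw_Path[OF trans_congL.hyps(1)] W[of _ H] by (auto simp: S)
  next
    case (trans_congR s x y z p q)
    then show ?case using rw_Path[OF trans_congR.hyps(2)] W[of _ H] by (auto simp: S)
  qed (simp_all add: S W E inv_cancel)
qed

section \<open>Types with a single vertex\<close>

lemma pi1_carrier: "carrier (pi1 H x) = Path H x x // rweq H x x"
  by (simp add: pi1_def quotient_monoid_def)

lemma pi1_one: "\<one>\<^bsub>pi1 H x\<^esub> = rweq H x x `` {Refl x}"
  by (simp add: pi1_def quotient_monoid_def)

lemma pi1_mult:
  assumes "p \<in> Path H x x" and "q \<in> Path H x x"
  shows "rweq H x x `` {p} \<otimes>\<^bsub>pi1 H x\<^esub> rweq H x x `` {q} = rweq H x x `` {Trans p q}"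
  unfolding pi1_def
  by (rule quotient_monoid_mult[OF equiv_rweq _ assms], rule congruent2I')
    (rule equiv_class_eq[OF equiv_rweq rweq_Trans])

lemma pi1_inv:
  assumes "p \<in> Path H x x"
  shows "inv\<^bsub>pi1 H x\<^esub> (rweq H x x `` {p}) = rweq H x x `` {Symm p}"
proof (rule group.inv_equality[OF group_pi1])
  have "(Trans (Symm p) p, Refl x) \<in> rweq H x x"
    by (rule rw_imp_rweq[OF rw.tsr[OF assms]])
  then show "rweq H x x `` {Symm p} \<otimes>\<^bsub>pi1 H x\<^esub> rweq H x x `` {p} = \<one>\<^bsub>pi1 H x\<^esub>"
    using assms equiv_class_eq[OF equiv_rweq] by (simp add: pi1_mult pi1_one Path_intros)
qed (use assms in \<open>auto simp: pi1_carrier intro: quotientI Path_intros\<close>)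

text \<open>The type \<open>'p\<close> may contain further points, but none is joined to
  \<open>x\<close>, since every edge is a loop at \<open>x\<close>.\<close>

locale one_vertex_hit =
  fixes H :: "('p, 'e) hit" and x :: 'p
  assumes edges_loops: "\<And>e. e \<in> edges H \<Longrightarrow> src H e = x \<and> tgt H e = x"
    and cells_loops: "cells H \<subseteq> Path H x x \<times> Path H x x"
begin

definition gen_class :: "'e \<Rightarrow> ('p, 'e) cpath set" where
  "gen_class e = rweq H x x `` {Gen e}"

lemma Gen_loop: "e \<in> edges H \<Longrightarrow> Gen e \<in> Path H x x"
  using Path_intros(2)[of e H] edges_loops by simp

lemma gen_class_closed: "gen_class \<in> edges H \<rightarrow> carrier (pi1 H x)"
  by (simp add: gen_class_def pi1_carrier quotientI Gen_loop)

text \<open>The midpoint of a \<open>Trans\<close> is not visible from its endpoints; this forces it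
  to be \<open>x\<close>, so every subpath of a loop at \<open>x\<close> is again a loop at
  \<open>x\<close>.\<close>

lemma Path_at_vertex_iff: "is_path H y z p \<Longrightarrow> y = x \<longleftrightarrow> z = x"
  by (induction rule: is_path.induct) (auto dest: edges_loops)

lemma word_eval_path_word:
  assumes "p \<in> Path H x x"
  shows "word_eval (pi1 H x) gen_class (path_word p) = rweq H x x `` {p}"
proof -
  interpret group "pi1 H x" by (rule group_pi1)
  \<comment> \<open>Rule induction needs free endpoints, so being based at \<open>x\<close> is
    carried as a premise on the source alone.\<close>
  have "is_path H y z p \<Longrightarrow> y = x \<Longrightarrow>
      word_eval (pi1 H x) gen_class (path_word p) = rweq H x x `` {p}" for y z
  proof (induction rule: is_path.induct)
    case (Refl y)
    then show ?case by (simp add: pi1_one)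
  next
    case (Gen e)
    then have "gen_class e \<in> carrier (pi1 H x)" using gen_class_closed by auto
    then show ?case by (simp add: gen_class_def)
  next
    case (Symm y z p)
    then have "y = x" using Path_at_vertex_iff by blast
    with Symm have "p \<in> Path H x x" by (simp add: Path_def)
    with Symm \<open>y = x\<close> show ?case
      by (simp add: word_eval_word_inv[OF gen_class_closed] path_word_in_words pi1_inv)
  next
    case (Trans y z p w q)
    then have "z = x" "w = x" using Path_at_vertex_iff by blast+
    with Trans have "p \<in> Path H x x" "q \<in> Path H x x" by (simp_all add: Path_def)
    with Trans \<open>z = x\<close> show ?case
      by (simp add: word_eval_append[OF gen_class_closed] path_word_in_words pi1_mult)
  qed
  then show ?thesis using assms by (simp add: Path_def)
qed

text \<open>Letters become \<open>Gen e\<close> or \<open>Symm (Gen e)\<close>; any two of them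
  compose because all edges are loops at \<open>x\<close>. This lifts kernel elements to actual
  paths.\<close>

lemma path_of_word:
  assumes "w \<in> words (edges H)"
  obtains p where "p \<in> Path H x x" and "path_word p = w"
proof -
  have "\<exists>p\<in>Path H x x. path_word p = w" using assms
  proof (induction w)
    case Nil
    then show ?case using Path_intros(1) by force
  next
    case (Cons l w)
    then obtain p where p: "p \<in> Path H x x" "path_word p = w" by auto
    obtain e b where l: "l = (e, b)" by (cases l)
    let ?l = "if b then Gen e else Symm (Gen e)"
    have "?l \<in> Path H x x" using Cons.prems l by (auto intro: Gen_loop Path_intros)
    then have "Trans ?l p \<in> Path H x x" using p by (blast intro: Path_intros)
    moreover have "path_word (Trans ?l p) = l # w" using p l by (simp add: word_inv_def)
    ultimately show ?case by blast
  qed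
  then show ?thesis using that by blast
qed

theorem pi1_iso_presented_group: "pi1 H x \<cong> presented_group (edges H) (cell_words H)"
proof -
  let ?F = "free_group (edges H)" and ?P = "pi1 H x"
  let ?c = "\<lambda>w. word_rel (edges H) `` {w}"
  let ?\<phi> = "free_lift ?P gen_class"
  define N where "N = normal_closure ?F (?c ` cell_words H)"
  interpret F: group ?F by (rule group_free_group)
  interpret P: group ?P by (rule group_pi1)
  interpret \<phi>: group_hom ?F ?P ?\<phi>
    by unfold_locales (rule P.free_lift_hom[OF gen_class_closed])
  have c: "?c w \<in> carrier ?F" if "w \<in> words (edges H)" for w
    using that by (simp add: carrier_free_group quotientI)
  have \<phi>_path: "?\<phi> (?c (path_word p)) = rweq H x x `` {p}" if "p \<in> Path H x x" for p
    using that P.free_lift_class[OF gen_class_closed] path_word_in_words[OF that]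
      word_eval_path_word by simp
  have cell_words: "cell_words H \<subseteq> words (edges H)"
    using cells_loops path_word_in_words by (fastforce simp: cell_words_def)
  then have "?c ` cell_words H \<subseteq> carrier ?F" using c by blast
  then have "N \<lhd> ?F" unfolding N_def by (rule F.normal_normal_closure)
  then interpret N: normal N ?F .
  interpret Q: group "?F Mod N" by (rule N.factorgroup_is_group)
  have gen_N: "?c w \<in> N" if "w \<in> cell_words H" for w
    using that by (auto simp: N_def normal_closure_def)

  \<comment> \<open>The kernel is normal and \<open>N\<close> is the least normal subgroup
    containing the relators, so it suffices to check each relator.\<close>
  have "N \<subseteq> kernel ?F ?P ?\<phi>"
  proof -
    have "?c w \<in> kernel ?F ?P ?\<phi>" if w: "w \<in> cell_words H" for w
    proof -
      \<comment> \<open>The relator is itself the reading of a loop, which makes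
        \<open>\<phi>_path\<close> applicable to it.\<close>
      obtain p q where pq: "(p, q) \<in> cells H" "w = path_word (Trans p (Symm q))"
        using w by (auto simp: cell_words_def)
      then have path: "p \<in> Path H x x" "q \<in> Path H x x" using cells_loops by auto
      have "(p, q) \<in> rweq H x x"
        by (rule rw_imp_rweq[OF rw.cell[OF pq(1) path]])
      then have eq: "rweq H x x `` {p} = rweq H x x `` {q}" by (rule equiv_class_eq[OF equiv_rweq])
      have "rweq H x x `` {Trans p (Symm q)} =
          rweq H x x `` {p} \<otimes>\<^bsub>?P\<^esub> inv\<^bsub>?P\<^esub> (rweq H x x `` {q})"
        using pi1_mult[OF path(1) Path_intros(3)[OF path(2)]] pi1_inv[OF path(2)] by simp
      also have "\<dots> = \<one>\<^bsub>?P\<^esub>"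
        unfolding eq by (rule P.r_inv) (simp add: pi1_carrier quotientI path)
      finally have "rweq H x x `` {Trans p (Symm q)} = \<one>\<^bsub>?P\<^esub>" .
      moreover have "Trans p (Symm q) \<in> Path H x x" using path by (blast intro: Path_intros)
      ultimately have "?\<phi> (?c w) = \<one>\<^bsub>?P\<^esub>" using \<phi>_path pq(2) by metis
      moreover have "?c w \<in> carrier ?F" using c cell_words w by blast
      ultimately show ?thesis by (simp add: kernel_def)
    qed
    then show ?thesis
      unfolding N_def normal_closure_def using \<phi>.normal_kernel by blast
  qed
  moreover have "kernel ?F ?P ?\<phi> \<subseteq> N"
  proof
    fix A assume A: "A \<in> kernel ?F ?P ?\<phi>"
    then obtain w where w: "w \<in> words (edges H)" "A = ?c w"
      by (auto simp: kernel_def carrier_free_group elim: quotientE)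
    then obtain p where p: "p \<in> Path H x x" "path_word p = w" using path_of_word by blast
    have "rweq H x x `` {p} = rweq H x x `` {Refl x}"
      using A w p \<phi>_path[OF p(1)] by (simp add: kernel_def pi1_one)
    then have "(p, Refl x) \<in> rweq H x x"
      using eq_equiv_class[OF _ equiv_rweq] Path_intros(1) by metis
    then have rw: "equivclp (rw H x x) p (Refl x)" by (simp add: rweq_def)

    \<comment> \<open>Evaluating with \<open>?h\<close> computes the projection of the free group
      onto its quotient by \<open>N\<close>, so questions about cosets become questions about
      \<open>word_eval\<close>.\<close>
    let ?h = "\<lambda>e. N #>\<^bsub>?F\<^esub> ?c [(e, True)]"
    have coset: "N #>\<^bsub>?F\<^esub> ?c u = word_eval (?F Mod N) ?h u" if "u \<in> words (edges H)" for u
      by (rule Q.hom_free_group_eq_word_eval[OF N.r_coset_hom_Mod that])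
    have h: "?h \<in> edges H \<rightarrow> carrier (?F Mod N)"
      using hom_in_carrier[OF N.r_coset_hom_Mod c] by simp
    \<comment> \<open>The cell hypothesis of \<open>word_eval_rw\<close>: the relator of a 2-cell
      lies in \<open>N\<close>, so its coset is the identity of the quotient.\<close>
    have "word_eval (?F Mod N) ?h (path_word p) = word_eval (?F Mod N) ?h (path_word q)"
      if pq: "(p, q) \<in> cells H" for p q
    proof -
      have "p \<in> Path H x x" "q \<in> Path H x x" using pq cells_loops by auto
      then have wd: "path_word p \<in> words (edges H)" "path_word q \<in> words (edges H)"
        by (simp_all add: path_word_in_words)
      let ?r = "path_word p @ word_inv (path_word q)"
      have "?r \<in> cell_words H" using pq by (force simp: cell_words_def)
      then have "N #>\<^bsub>?F\<^esub> ?c ?r = N" using gen_N N.rcos_const by simp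
      then have "word_eval (?F Mod N) ?h ?r = \<one>\<^bsub>?F Mod N\<^esub>"
        using coset[of ?r] wd by simp
      then show ?thesis by (rule Q.word_eval_eq_if_quotient_one[OF h wd])
    qed
    note step_eq = Q.word_eval_rw[OF h this]
    from rw have "word_eval (?F Mod N) ?h (path_word p) =
        word_eval (?F Mod N) ?h (path_word (Refl x))"
    proof (induction rule: converse_equivclp_induct)
      case (step q r)
      \<comment> \<open>A link of the zigzag may be a rewrite in either direction, hence both
        instances.\<close>
      then show ?case using step_eq[of x x q r] step_eq[of x x r q] by metis
    qed (rule refl)
    then have "N #>\<^bsub>?F\<^esub> A = N" using coset[OF w(1)] w p by simp
    \<comment> \<open>A coset contains its representative, so a trivial coset puts \<open>A\<close>
      in \<open>N\<close>.\<close>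
    moreover have "A \<in> N #>\<^bsub>?F\<^esub> A"
      using F.rcos_self[OF _ N.subgroup_axioms] c w by blast
    ultimately show "A \<in> N" by simp
  qed
  ultimately have "kernel ?F ?P ?\<phi> = N" by blast
  \<comment> \<open>Surjectivity: the class of a loop is the image of the class of its own
    reading.\<close>
  moreover have "?\<phi> ` carrier ?F = carrier ?P"
  proof
    show "carrier ?P \<subseteq> ?\<phi> ` carrier ?F"
    proof
      fix A assume "A \<in> carrier ?P"
      then obtain p where p: "p \<in> Path H x x" "A = rweq H x x `` {p}"
        by (auto simp: pi1_carrier elim: quotientE)
      then show "A \<in> ?\<phi> ` carrier ?F"
        using \<phi>_path[OF p(1)] c[OF path_word_in_words[OF p(1)]] by (metis imageI)
    qed
  qed auto
  ultimately have "?F Mod N \<cong> ?P" using \<phi>.FactGroup_iso by simp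
  then have "?P \<cong> ?F Mod N" by (rule Q.iso_sym)
  then show ?thesis by (simp add: presented_group_def N_def)
qed

end

lemma one_vertex_Sigma_surface: "one_vertex_hit (Sigma_surface g) base"
  using surface_path_in_Path[of g]
  by unfold_locales (auto simp: Sigma_surface_def intro: Path_intros)

text \<open>An equality on the nose, without free reduction: reading flattens the bracketing of
  \<open>Trans\<close>, and the final \<open>Refl base\<close> contributes the empty word.\<close>

lemma path_word_surface_path: "path_word (surface_path g) = surface_word g"
proof -
  have "path_word (foldr (\<lambda>i. Trans (comm_path (Gen (loop_a i)) (Gen (loop_b i)))) ns (Refl base))
      = concat (map (\<lambda>i. comm_word (loop_a i) (loop_b i)) ns)" for ns
    by (induction ns) (simp_all add: comm_path_def comm_word_def word_inv_def)
  then show ?thesis by (simp add: surface_path_def surface_word_def del: upt_Suc)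
qed

theorem mainTheorem9:
  fixes g :: nat
  shows "pi1 (Sigma_surface g) base \<cong> presented_group (surface_gens g) {surface_word g}"
proof -
  have "edges (Sigma_surface g) = surface_gens g" by (simp add: Sigma_surface_def)
  \<comment> \<open>The other side of the only 2-cell is \<open>Refl base\<close>, whose inverse
    reading is empty, so the relator is exactly the surface word. For \<open>g = 0\<close> it is the
    empty word.\<close>
  moreover have "cell_words (Sigma_surface g) = {surface_word g}"
    by (simp add: cell_words_def Sigma_surface_def path_word_surface_path word_inv_def)
  ultimately show ?thesis
    using one_vertex_hit.pi1_iso_presented_group[OF one_vertex_Sigma_surface, of g] by simp
qed

end
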